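(* Let $ABC$ be a triangle whose orthocenter $H$ lies inside $\triangle ABC$, and let the cevians through $H$ be $AD$, $BE$, $CF$, with $D$ on side $BC$, $E$ on side $CA$, $F$ on side $AB$. Let $r_1$ be the radius of the excircle of $\triangle BHD$ that touches side $BD$, $r_2$ the radius of the excircle of $\triangle CHD$ that touches side $DC$, $r_3$ the radius of the excircle of $\triangle CHE$ that touches side $CE$, $r_4$ the radius of the excircle of $\triangle AHE$ that touches side $EA$, $r_5$ the radius of the excircle of $\triangle AHF$ that touches side $AF$, and $r_6$ the radius of the excircle of $\triangle BHF$ that touches side $FB$. Then $$r_1r_3r_5=r_2r_4r_6.$$
   Context: A cevian through a point $P$ inside a triangle is the segment from a vertex through $P$ to the opposite side. The excircle of a triangle that touches a given side is the circle tangent to that side (segment) and to the extensions of the other two sides, lying on the opposite side of that segment from the remaining vertex. *)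

theory Defs
  imports "HOL-Analysis.Analysis"
begin

type_synonym point = "real^2"

definition line :: "point \<Rightarrow> point \<Rightarrow> point set" where
  "line P Q = affine hull {P, Q}"

definition altitude :: "point \<Rightarrow> point \<Rightarrow> point \<Rightarrow> point set" where
  "altitude A B C = {X. orthogonal (X - A) (C - B)}"

definition is_orthocenter :: "point \<Rightarrow> point \<Rightarrow> point \<Rightarrow> point \<Rightarrow> bool" where
  "is_orthocenter H A B C \<longleftrightarrow>
     H \<in> altitude A B C \<and> H \<in> altitude B C A \<and> H \<in> altitude C A B"

text \<open>\<open>is_cevian P A B C D\<close>: the segment \<open>AD\<close> is the cevian through \<open>P\<close> from the
  vertex \<open>A\<close> of triangle \<open>ABC\<close>.\<close>

definition is_cevian :: "point \<Rightarrow> point \<Rightarrow> point \<Rightarrow> point \<Rightarrow> point \<Rightarrow> bool" where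
  "is_cevian P A B C D \<longleftrightarrow> D \<in> closed_segment B C \<and> P \<in> closed_segment A D"

definition tangent_at :: "point set \<Rightarrow> point set \<Rightarrow> point \<Rightarrow> bool" where
  "tangent_at \<omega> l T \<longleftrightarrow> \<omega> \<inter> l = {T}"

text \<open>The extension of the side \<open>VP\<close> beyond \<open>P\<close>.\<close>

definition extension :: "point \<Rightarrow> point \<Rightarrow> point set" where
  "extension V P = {X. P \<in> open_segment V X}"

text \<open>\<open>is_excircle V P Q Z r\<close>: the circle with centre \<open>Z\<close> and radius \<open>r\<close> is the excircle
  of triangle \<open>VPQ\<close> that touches the side \<open>PQ\<close>. The last conjunct says that the circle
  lies on the opposite side of \<open>PQ\<close> from \<open>V\<close>; closed segments are used there because
  the point of tangency with \<open>PQ\<close> lies on \<open>PQ\<close> itself.\<close>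

definition is_excircle :: "point \<Rightarrow> point \<Rightarrow> point \<Rightarrow> point \<Rightarrow> real \<Rightarrow> bool" where
  "is_excircle V P Q Z r \<longleftrightarrow>
     r > 0 \<and>
     (\<exists>T \<in> closed_segment P Q. tangent_at (sphere Z r) (line P Q) T) \<and>
     (\<exists>T \<in> extension V P. tangent_at (sphere Z r) (line V P) T) \<and>
     (\<exists>T \<in> extension V Q. tangent_at (sphere Z r) (line V Q) T) \<and>
     (\<forall>X \<in> sphere Z r. closed_segment V X \<inter> line P Q \<noteq> {})"

definition is_exradius :: "point \<Rightarrow> point \<Rightarrow> point \<Rightarrow> real \<Rightarrow> bool" where
  "is_exradius V P Q r \<longleftrightarrow> (\<exists>Z. is_excircle V P Q Z r)"

end

theory Submission imports Defs begin

text \<open>In a right triangle the excircle beyond a leg has radius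
  (this leg + hypotenuse - other leg) / 2, by comparing tangent lengths. For \<open>BHD\<close> and
  \<open>AHE\<close> the leg to be subtracted is \<open>HD\<close> and \<open>HE\<close>, respectively, and
  \<open>HD \<cdot> HA = HE \<cdot> HB\<close>, so that these triangles are similar and
  \<open>r\<^sub>1 / HB = r\<^sub>4 / HA\<close>. Likewise \<open>r\<^sub>3 / HC = r\<^sub>6 / HB\<close> and \<open>r\<^sub>5 / HA = r\<^sub>2 / HC\<close>;
  multiplying the three equations gives the claim.\<close>

lemma mem_line_iff: "X \<in> line P Q \<longleftrightarrow> (\<exists>t. X = P + t *\<^sub>R (Q - P))"
proof
  assume "X \<in> line P Q"
  then obtain u v where "X = u *\<^sub>R P + v *\<^sub>R Q" "u + v = 1"
    by (auto simp: line_def affine_hull_2)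
  moreover from this(2) have "u = 1 - v" by simp
  ultimately have "X = P + v *\<^sub>R (Q - P)"
    by (simp add: algebra_simps)
  then show "\<exists>t. X = P + t *\<^sub>R (Q - P)" ..
next
  assume "\<exists>t. X = P + t *\<^sub>R (Q - P)"
  then obtain t where "X = P + t *\<^sub>R (Q - P)" ..
  then have "X = (1 - t) *\<^sub>R P + t *\<^sub>R Q" "(1 - t) + t = 1"
    by (simp_all add: algebra_simps)
  then show "X \<in> line P Q"
    unfolding line_def affine_hull_2 by blast
qed

text \<open>Tangency is encoded as meeting in exactly one point. Reflecting \<open>T\<close> in the
  foot of the perpendicular from \<open>Z\<close> stays on the line and on the circle, so
  \<open>T\<close> must be that foot.\<close>

lemma tangent_orthogonal:
  assumes "tangent_at (sphere Z r) (line P Q) T"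
  shows "orthogonal (Z - T) (Q - P)"
proof (cases "P = Q")
  case False
  define d where "d = Q - P"
  define c where "c = (Z - T) \<bullet> d / (d \<bullet> d)"
  \<comment> \<open>the reflection of \<open>T\<close> in the foot of the perpendicular from \<open>Z\<close>\<close>
  define S where "S = T + (2 * c) *\<^sub>R d"
  have d: "d \<bullet> d \<noteq> 0" using False by (simp add: d_def)
  have T: "T \<in> sphere Z r" "T \<in> line P Q"
    using assms by (auto simp: tangent_at_def)
  from T(2) obtain t where "T = P + t *\<^sub>R d"
    by (auto simp: mem_line_iff d_def)
  then have "S = P + (t + 2 * c) *\<^sub>R d"
    by (simp add: S_def algebra_simps)
  then have "S \<in> line P Q"
    by (auto simp: mem_line_iff d_def)
  moreover have "(dist Z S)\<^sup>2 = (dist Z T)\<^sup>2"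
  proof -
    have "(dist Z S)\<^sup>2 = (Z - T) \<bullet> (Z - T) - 4 * c * ((Z - T) \<bullet> d) + 4 * c * (c * (d \<bullet> d))"
      by (simp add: S_def dist_norm power2_norm_eq_inner inner_simps inner_commute algebra_simps)
    also have "c * (d \<bullet> d) = (Z - T) \<bullet> d"
      using d by (simp add: c_def)
    finally show ?thesis
      by (simp add: dist_norm power2_norm_eq_inner)
  qed
  then have "S \<in> sphere Z r" using T(1) by (simp add: power2_eq_iff_nonneg)
  ultimately have "S = T"
    using assms unfolding tangent_at_def by blast
  then have "c = 0" using d by (simp add: S_def)
  then show ?thesis
    using d by (simp add: c_def orthogonal_def d_def)
qed (simp add: orthogonal_def)

text \<open>Pythagoras in the triangle \<open>X T Z\<close>. The right-hand side does not involve
  \<open>T\<close>, so two tangents from \<open>X\<close> to one circle have equal length.\<close>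

lemma tangent_length:
  assumes "tangent_at (sphere Z r) (line P Q) T" and "X \<in> line P Q"
  shows "(dist X T)\<^sup>2 = (dist X Z)\<^sup>2 - r\<^sup>2"
proof -
  have T: "dist Z T = r" "T \<in> line P Q"
    using assms by (auto simp: tangent_at_def)
  obtain s t where "X = P + s *\<^sub>R (Q - P)" "T = P + t *\<^sub>R (Q - P)"
    using assms(2) T(2) by (auto simp: mem_line_iff)
  then have "X - T = (s - t) *\<^sub>R (Q - P)" by (simp add: scaleR_left_diff_distrib)
  then have "orthogonal (X - T) (Z - T)"
    using tangent_orthogonal[OF assms(1)]
    by (simp add: orthogonal_def inner_commute)
  then have "(norm (X - T))\<^sup>2 + (norm (Z - T))\<^sup>2 = (norm ((X - T) - (Z - T)))\<^sup>2"
    by (simp add: orthogonal_def power2_norm_eq_inner inner_simps inner_commute)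
  then show ?thesis using T(1) by (simp add: dist_norm)
qed

lemma endpoints_mem_line: "P \<in> line P Q" "Q \<in> line P Q"
  by (auto simp: line_def hull_inc)

lemma is_exradius_commute:
  assumes "is_exradius V P Q r"
  shows "is_exradius V Q P r"
  using assms
  by (auto simp: is_exradius_def is_excircle_def line_def closed_segment_commute insert_commute)

text \<open>Two nonzero orthogonal vectors span the plane, so \<open>x\<close> is orthogonal to
  itself.\<close>

lemma orthogonal_both_eq_0:
  fixes x u w :: "real^2"
  assumes "orthogonal u w" "u \<noteq> 0" "w \<noteq> 0" "orthogonal x u" "orthogonal x w"
  shows "x = 0"
proof -
  have "pairwise orthogonal {u, w}"
    using assms(1) by (auto simp: pairwise_insert orthogonal_commute)
  then have ind: "independent {u, w}"
    by (rule pairwise_orthogonal_independent) (use assms(2,3) in auto)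
  have "u \<noteq> w" using assms(1,2) by (auto simp: orthogonal_self)
  have "span {u, w} = UNIV"
    using ind \<open>u \<noteq> w\<close> card_ge_dim_independent[of "{u, w}" UNIV] by auto
  then have "orthogonal x x"
    using assms by (metis UNIV_I orthogonal_to_span empty_iff insert_iff)
  then show ?thesis by (simp add: orthogonal_self)
qed

lemma is_exradius_apex_neq:
  assumes "is_exradius V P Q r"
  shows "V \<noteq> P" "V \<noteq> Q"
  using assms by (auto simp: is_exradius_def is_excircle_def extension_def open_segment_def)

text \<open>The equal tangents from \<open>V\<close> give \<open>VQ + QT2 = VP + PT3\<close>, where
  \<open>QT2 = QT1\<close> and \<open>PT3 = PT1\<close> add up to \<open>PQ\<close>; this determines
  \<open>QT2\<close>. The right angle at \<open>Q\<close> makes \<open>QT2\<close> equal to the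
  radius.\<close>

lemma exradius_right_triangle:
  assumes "is_exradius V P Q r" and orth: "orthogonal (V - Q) (P - Q)"
  shows "2 * r = dist P Q + dist V P - dist V Q"
proof -
  from assms(1) obtain Z T1 T2 T3 where r: "r > 0"
    and T1: "T1 \<in> closed_segment P Q" "tangent_at (sphere Z r) (line P Q) T1"
    and T3: "P \<in> open_segment V T3" "tangent_at (sphere Z r) (line V P) T3"
    and T2: "Q \<in> open_segment V T2" "tangent_at (sphere Z r) (line V Q) T2"
    by (auto simp: is_exradius_def is_excircle_def extension_def)
  have "P \<noteq> Q"
  proof
    assume "P = Q"
    then have "P \<in> sphere Z r" using T1 by (auto simp: tangent_at_def)
    then have "P = T3" using T3(2) endpoints_mem_line by (auto simp: tangent_at_def)
    then show False using T3(1) by (simp add: open_segment_def)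
  qed
  have "V \<noteq> Q" using assms(1) is_exradius_apex_neq by blast
  have "dist V T2 = dist V T3" "dist Q T1 = dist Q T2" "dist P T1 = dist P T3"
    using T1(2) T2(2) T3(2)
    by (auto simp: power2_eq_iff_nonneg[symmetric] tangent_length endpoints_mem_line)
  moreover have "dist V T2 = dist V Q + dist Q T2" "dist V T3 = dist V P + dist P T3"
    "dist P Q = dist P T1 + dist T1 Q"
    using T1(1) T2(1) T3(1) by (auto simp: open_segment_def between_mem_segment[symmetric] between)
  ultimately have "2 * dist Q T2 = dist P Q + dist V P - dist V Q"
    by (simp add: dist_commute)
  moreover have "dist Q T2 = r"
  proof -
    \<comment> \<open>\<open>Q\<close>, \<open>T1\<close>, \<open>Z\<close>, \<open>T2\<close> form a rectangle.\<close>
    have "T1 \<in> line P Q" "T2 \<in> line V Q"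
      using T1 T2 by (auto simp: tangent_at_def)
    then obtain s t where st: "T1 = P + s *\<^sub>R (Q - P)" "T2 = V + t *\<^sub>R (Q - V)"
      by (auto simp: mem_line_iff)
    then have eqs: "T1 - Q = (1 - s) *\<^sub>R (P - Q)" "T2 - Q = (1 - t) *\<^sub>R (V - Q)"
      by (simp_all add: algebra_simps)
    \<comment> \<open>The vector by which the quadrilateral fails to be a parallelogram. Its two
      groupings of terms show orthogonality to one leg each.\<close>
    let ?x = "(Z - T1) - (T2 - Q)"
    have x: "?x = (Z - T2) - (T1 - Q)" by simp
    have "(Z - T1) \<bullet> (P - Q) = 0" "(Z - T2) \<bullet> (V - Q) = 0"
      using tangent_orthogonal[OF T1(2)] tangent_orthogonal[OF T2(2)]
      by (simp_all add: orthogonal_def inner_diff_right)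
    moreover have "(V - Q) \<bullet> (P - Q) = 0" "(P - Q) \<bullet> (V - Q) = 0"
      using orth by (simp_all add: orthogonal_def inner_commute)
    ultimately have "?x \<bullet> (P - Q) = 0" "((Z - T2) - (T1 - Q)) \<bullet> (V - Q) = 0"
      by (simp_all only: eqs inner_diff_left[of "Z - T1"] inner_diff_left[of "Z - T2"]
          inner_scaleR_left mult_zero_right diff_zero)
    then have "orthogonal ?x (P - Q)" "orthogonal ?x (V - Q)"
      unfolding x by (simp_all only: orthogonal_def)
    then have "?x = 0"
      using orthogonal_both_eq_0[OF orth, of ?x] \<open>P \<noteq> Q\<close> \<open>V \<noteq> Q\<close> by simp
    moreover have "dist Z T1 = r" using T1(2) by (auto simp: tangent_at_def)
    ultimately show ?thesis by (simp add: dist_norm norm_minus_commute)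
  qed
  ultimately show ?thesis by simp
qed

text \<open>As \<open>H\<close> differs from \<open>A\<close>, the altitude through \<open>H\<close>
  has the direction of \<open>AD\<close>. Since \<open>H\<close> lies between \<open>A\<close> and
  \<open>D\<close>, the product is \<open>- ((A - H) \<bullet> (D - H))\<close>, and moving
  \<open>D\<close> to \<open>X\<close> adds only a vector orthogonal to \<open>AD\<close>. The
  resulting form is symmetric in \<open>A\<close> and \<open>X\<close>, so two altitudes can be
  compared.\<close>

lemma foot_of_altitude:
  assumes "H \<in> altitude A B C" "is_cevian H A B C D" "H \<noteq> A" "X \<in> {B, C}"
  shows "orthogonal (H - D) (X - D)"
    and "dist H D * dist H A = - ((A - H) \<bullet> (X - H))"
proof -
  obtain u where D: "D = (1 - u) *\<^sub>R B + u *\<^sub>R C"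
    using assms(2) by (auto simp: is_cevian_def in_segment)
  obtain k where k: "0 \<le> k" "k \<le> 1" "H = (1 - k) *\<^sub>R A + k *\<^sub>R D"
    using assms(2) by (auto simp: is_cevian_def in_segment)
  have HA: "H - A = k *\<^sub>R (D - A)" and HD: "H - D = (1 - k) *\<^sub>R (A - D)"
    by (simp_all add: k algebra_simps)
  have "(H - A) \<bullet> (C - B) = 0" using assms(1) by (simp add: altitude_def orthogonal_def)
  moreover have "k \<noteq> 0" using HA assms(3) by auto
  ultimately have "(D - A) \<bullet> (C - B) = 0" by (simp add: HA)
  moreover obtain c where "X - D = c *\<^sub>R (C - B)"
  proof -
    have "B - D = (- u) *\<^sub>R (C - B)" "C - D = (1 - u) *\<^sub>R (C - B)"
      by (simp_all add: D algebra_simps)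
    then show thesis using assms(4) that by blast
  qed
  ultimately have 0: "(A - D) \<bullet> (X - D) = 0"
    by (metis inner_minus_left inner_scaleR_right minus_diff_eq mult_zero_right neg_0_equal_iff_equal)
  then show "orthogonal (H - D) (X - D)" by (simp add: orthogonal_def HD)
  have AH: "A - H = k *\<^sub>R (A - D)" and XH: "X - H = (X - D) - (1 - k) *\<^sub>R (A - D)"
    by (simp_all add: k algebra_simps)
  have "dist H D * dist H A = k * (1 - k) * ((A - D) \<bullet> (A - D))"
    using k(1,2) by (simp add: dist_norm HA HD norm_minus_commute power2_norm_eq_inner[symmetric]
        power2_eq_square)
  also have "\<dots> = - ((A - H) \<bullet> (X - H))"
    by (simp only: AH XH inner_scaleR_left inner_diff_right[of _ "X - D"] inner_scaleR_right 0)
      simp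
  finally show "dist H D * dist H A = - ((A - H) \<bullet> (X - H))" .
qed

text \<open>Scaling \<open>HBD\<close> by \<open>dist H A\<close> and \<open>HAE\<close> by
  \<open>dist H B\<close> gives right triangles with equal hypotenuses and, by \<open>eq\<close>,
  one equal leg. Pythagoras matches the other leg, and the exradius formula is linear in the
  sides.\<close>

lemma exradii_similar_right_triangles:
  assumes "is_exradius H B D r" "is_exradius H A E r'"
    and "orthogonal (H - D) (B - D)" "orthogonal (H - E) (A - E)"
    and eq: "dist H D * dist H A = dist H E * dist H B"
  shows "r * dist H A = r' * dist H B"
proof -
  have leg: "(dist X Y)\<^sup>2 = (dist H X)\<^sup>2 - (dist H Y)\<^sup>2"
    if "orthogonal (H - Y) (X - Y)" for X Y :: point
  proof -
    have "(norm (H - Y))\<^sup>2 + (norm (X - Y))\<^sup>2 = (norm ((H - Y) - (X - Y)))\<^sup>2"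
      using that by (simp add: orthogonal_def power2_norm_eq_inner inner_simps inner_commute)
    then show ?thesis by (simp add: dist_norm)
  qed
  have "(dist B D * dist H A)\<^sup>2 = (dist H B * dist H A)\<^sup>2 - (dist H D * dist H A)\<^sup>2"
    by (simp add: power_mult_distrib leg[OF assms(3)] left_diff_distrib)
  also have "\<dots> = (dist A E * dist H B)\<^sup>2"
    unfolding eq by (simp add: power_mult_distrib leg[OF assms(4)] left_diff_distrib)
  finally have "dist B D * dist H A = dist A E * dist H B"
    by (simp add: power2_eq_iff_nonneg)
  then have "2 * r * dist H A = 2 * r' * dist H B"
    unfolding exradius_right_triangle[OF assms(1,3)] exradius_right_triangle[OF assms(2,4)]
    using eq by (simp add: ring_distribs)
  then show ?thesis by simp
qed

lemma exradii_altitudes: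
  assumes "is_exradius H B D r" "is_exradius H A E r'"
    and "H \<in> altitude A B C" "H \<in> altitude B C A"
    and "is_cevian H A B C D" "is_cevian H B C A E"
  shows "r * dist H A = r' * dist H B"
proof (rule exradii_similar_right_triangles[OF assms(1,2)])
  have "H \<noteq> A" "H \<noteq> B" using is_exradius_apex_neq assms(1,2) by blast+
  note D = foot_of_altitude[OF assms(3,5) \<open>H \<noteq> A\<close>, of B]
  note E = foot_of_altitude[OF assms(4,6) \<open>H \<noteq> B\<close>, of A]
  show "orthogonal (H - D) (B - D)" "orthogonal (H - E) (A - E)"
    using D E by simp_all
  \<comment> \<open>With \<open>X = B\<close> for \<open>D\<close> and \<open>X = A\<close> for
    \<open>E\<close>, both products equal \<open>- ((A - H) \<bullet> (B - H))\<close>.\<close>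
  show "dist H D * dist H A = dist H E * dist H B"
    using D(2) E(2) by (simp add: inner_commute)
qed

theorem theorem2p2:
  fixes A B C D E F H :: point
    and r1 r2 r3 r4 r5 r6 :: real
  assumes "\<not> collinear {A, B, C}"
    and "is_orthocenter H A B C"
    and "H \<in> interior (convex hull {A, B, C})"
    and "is_cevian H A B C D"
    and "is_cevian H B C A E"
    and "is_cevian H C A B F"
    and "is_exradius H B D r1"
    and "is_exradius H D C r2"
    and "is_exradius H C E r3"
    and "is_exradius H E A r4"
    and "is_exradius H A F r5"
    and "is_exradius H F B r6"
  shows "r1 * r3 * r5 = r2 * r4 * r6"
proof -
  have alt: "H \<in> altitude A B C" "H \<in> altitude B C A" "H \<in> altitude C A B"
    using assms(2) by (auto simp: is_orthocenter_def)
  \<comment> \<open>Swapping the endpoints in the even-numbered triangles puts the foot, where the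
    right angle is, last in all six.\<close>
  note exr = assms(7,9,11) assms(8,10,12)[THEN is_exradius_commute]
  have "r1 * dist H A = r4 * dist H B"
    by (rule exradii_altitudes[OF exr(1,5) alt(1,2) assms(4,5)])
  moreover have "r3 * dist H B = r6 * dist H C"
    by (rule exradii_altitudes[OF exr(2,6) alt(2,3) assms(5,6)])
  moreover have "r5 * dist H C = r2 * dist H A"
    by (rule exradii_altitudes[OF exr(3,4) alt(3,1) assms(6,4)])
  ultimately have "(r1 * dist H A) * (r3 * dist H B) * (r5 * dist H C) =
      (r4 * dist H B) * (r6 * dist H C) * (r2 * dist H A)" by simp
  then have "(r1 * r3 * r5) * (dist H A * dist H B * dist H C) =
      (r2 * r4 * r6) * (dist H A * dist H B * dist H C)"
    by (simp only: ac_simps)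
  \<comment> \<open>An excircle touches the extensions strictly beyond the side's endpoints, so its
    apex \<open>H\<close> is none of \<open>A\<close>, \<open>B\<close>, \<open>C\<close>, and the
    common factor cancels.\<close>
  moreover have "H \<noteq> A" "H \<noteq> B" "H \<noteq> C"
    using exr(1-3) is_exradius_apex_neq by blast+
  ultimately show ?thesis by simp
qed

end
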